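(* Let $T$ be a rooted tree with $n>2$ vertices and maximum level $l_{\max}$. Then the multiplicity of $0$ as an eigenvalue of $L(T)$ is precisely $n-1-l_{\max}$. Moreover, $L(T)$ has exactly one positive eigenvalue (counted with multiplicity). Furthermore, $$\mathrm{mul}_T(0)-\mathrm{mul}_{T-v}(0)\in\{0,1\}$$ holds for all leaves $v$ of $T$.
   Context: A rooted tree is a finite tree with a distinguished vertex (the root). The level $l(v)$ of a vertex $v$ is its distance from the root, and $l_{\max}$ is the maximum level of a vertex. For a rooted tree $T$ with vertices $v_1,\dots,v_n$, the level matrix $L(T)=(l_{ij})$ is the $n\times n$ real symmetric matrix with $l_{ij}=|l(v_i)-l(v_j)|$. A leaf is a pendant vertex of $T$ (a non-root vertex of degree $1$). For a leaf $v$, $T-v$ denotes the rooted tree obtained from $T$ by deleting $v$ (with the same root). $\mathrm{mul}_T(\lambda)$ denotes the multiplicity of $\lambda$ as an eigenvalue of $L(T)$ (equal to $0$ if $\lambda$ is not an eigenvalue). *)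

theory Defs
  imports
    "Graph_Theory.Digraph_Component"
    "Jordan_Normal_Form.Char_Poly"
begin

text \<open>
  Finite simple undirected graphs are the locale \<^locale>\<open>graph\<close>: finite symmetric digraphs without
  loops or parallel arcs, so that an undirected edge is a pair of opposite arcs. Such a pair is
  already a cycle of length 2 in the sense of \<^const>\<open>pre_digraph.cycle\<close>, so the predicates
  \<^const>\<open>forest\<close> and \<^const>\<open>tree\<close> of the library do not describe undirected trees. The cycles of the
  undirected graph are exactly the directed cycles of length at least 3.
\<close>

locale rooted_tree = graph T for T :: "('a, 'b) pre_digraph" +
  fixes r :: 'a
  assumes root_in_verts: "r \<in> verts T"
    and tree_connected: "Digraph_Component.connected T"
    and tree_acyclic: "\<not> (\<exists>p. pre_digraph.cycle T p \<and> length p \<ge> 3)"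

definition dist_graph :: "('a, 'b) pre_digraph \<Rightarrow> 'a \<Rightarrow> 'a \<Rightarrow> nat" where
  "dist_graph G u v = (LEAST k. \<exists>p. pre_digraph.awalk G u p v \<and> length p = k)"

definition level :: "('a, 'b) pre_digraph \<Rightarrow> 'a \<Rightarrow> 'a \<Rightarrow> nat" where
  "level T r v = dist_graph T r v"

definition max_level :: "('a, 'b) pre_digraph \<Rightarrow> 'a \<Rightarrow> nat" where
  "max_level T r = Max (level T r ` verts T)"

definition enumerates :: "'a list \<Rightarrow> 'a set \<Rightarrow> bool" where
  "enumerates vs V \<longleftrightarrow> distinct vs \<and> set vs = V"

definition level_matrix :: "('a, 'b) pre_digraph \<Rightarrow> 'a \<Rightarrow> 'a list \<Rightarrow> real mat" where
  "level_matrix T r vs = mat (length vs) (length vs)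
     (\<lambda>(i, j). \<bar>real (level T r (vs ! i)) - real (level T r (vs ! j))\<bar>)"

text \<open>In a symmetric digraph the degree of a vertex is its out-degree.\<close>

definition leaf :: "('a, 'b) pre_digraph \<Rightarrow> 'a \<Rightarrow> 'a \<Rightarrow> bool" where
  "leaf T r v \<longleftrightarrow> v \<in> verts T \<and> v \<noteq> r \<and> out_degree T v = 1"

text \<open>
  Algebraic multiplicity; it is 0 if \<open>x\<close> is not an eigenvalue. For real symmetric matrices, such as
  level matrices, it coincides with the geometric multiplicity.
\<close>

definition eigen_mult :: "real mat \<Rightarrow> real \<Rightarrow> nat" where
  "eigen_mult A x = Polynomial.order x (char_poly A)"

end

theory Submission
  imports Defs
begin

text \<open>
  The only thing that the level matrix sees of the tree is how many vertices lie on each level, and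
  by connectedness the occupied levels are exactly \<open>0, \<dots>, m\<close>, where \<open>m\<close> is the maximum level
  (\<open>level_image\<close>). So let \<open>A\<close> be the \<open>n \<times> n\<close> matrix of distances \<open>\<bar>f i - f j\<bar>\<close> for a function
  \<open>f\<close> with image \<open>{0, \<dots>, m}\<close> and \<open>m > 0\<close>.

  Kernel: with the incidence matrix \<open>B\<close> of indices and values, \<open>A = B D B\<^sup>T\<close>, where \<open>D\<close> is the
  distance matrix of a path on \<open>0, \<dots>, m\<close>. Swapping the factors \<open>B\<close> and \<open>D B\<^sup>T\<close> only changes the
  characteristic polynomial by a power of \<open>x\<close> (\<open>char_poly_mult_commute\<close>), so that
  \<open>x\<^bsup>m+1\<^esup> \<chi>\<^sub>A = x\<^sup>n q\<close> with \<open>q\<close> the characteristic polynomial of \<open>D N\<close>, and \<open>N = B\<^sup>T B\<close> is the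
  diagonal matrix of the fibre sizes. Since \<open>det D = (m/2) (-2)\<^sup>m\<close> (\<open>det_path_distance_matrix\<close>),
  \<open>q\<close> does not vanish at 0. Hence the multiplicity of 0 is \<open>n - (m + 1)\<close>.

  Existence of a positive eigenvalue: the sign of that determinant even gives \<open>q(0) < 0\<close>
  (\<open>distance_matrix_char_poly\<close>), and \<open>q\<close> is monic, so it has a positive root.

  Uniqueness: as \<open>\<bar>a - b\<bar> = a + b - 2 \<Sum>\<^sub>l [l \<le> a] [l \<le> b]\<close> over \<open>l = 1, \<dots>, m\<close>, the quadratic form of \<open>A\<close> is
  nonpositive on the hyperplane orthogonal to the all-ones vector
  (\<open>distance_matrix_nonpos\<close>). A plane spanned by two orthogonal eigenvectors with positive
  eigenvalues would meet this hyperplane in a vector on which the form is positive. To account for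
  algebraic multiplicities, a positive eigenvalue \<open>k\<close> is deflated to 0: this replaces one factor
  \<open>x - k\<close> of \<open>\<chi>\<^sub>A\<close> by \<open>x\<close> (\<open>char_poly_deflation\<close>), and every eigenvector of the deflated matrix with
  positive eigenvalue would be an eigenvector of \<open>A\<close> orthogonal to the first one. So \<open>x \<chi>\<^sub>A\<close> is
  \<open>x - k\<close> times a polynomial without positive roots (\<open>order_positive_eigenvalue\<close>).

  Deleting a leaf: no shortest walk between other vertices runs through a leaf, so all other levels
  survive (\<open>level_del_leaf\<close>). Since the levels of the smaller tree again form an initial segment, the
  maximum level drops by at most one, while the number of vertices drops by exactly one.
\<close>

section \<open>Characteristic polynomials of products and deflation\<close>


lemma poly_char_poly:
  fixes A :: "'a :: field mat"
  assumes A: "A \<in> carrier_mat n n"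
  shows "poly (char_poly A) t = det (t \<cdot>\<^sub>m 1\<^sub>m n - A)"
proof -
  have "- char_matrix A t = t \<cdot>\<^sub>m 1\<^sub>m n - A"
    using A by (intro eq_matI) (auto simp: char_matrix_def)
  then show ?thesis using char_poly_matrix[OF A, of t] by simp
qed

text \<open>
  Sylvester's determinant identity, scaled so that it also makes sense for \<open>t = 0\<close>. Both sides are
  the determinant of the block matrix with rows \<open>(t I, A)\<close> and \<open>(B, I)\<close> up to a power of \<open>t\<close>:
  eliminating \<open>B\<close> leaves \<open>t I - A B\<close>, eliminating \<open>A\<close> leaves \<open>t I - B A\<close>.
\<close>

lemma det_mult_commute:
  fixes A B :: "'a :: idom mat"
  assumes A: "A \<in> carrier_mat n m" and B: "B \<in> carrier_mat m n"
  shows "t ^ m * det (t \<cdot>\<^sub>m 1\<^sub>m n - A * B) = t ^ n * det (t \<cdot>\<^sub>m 1\<^sub>m m - B * A)"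
proof -
  define M where "M = four_block_mat (t \<cdot>\<^sub>m 1\<^sub>m n) A B (1\<^sub>m m)"
  define L where "L = four_block_mat (1\<^sub>m n) (0\<^sub>m n m) (- B) (1\<^sub>m m)"
  define R where "R = four_block_mat (1\<^sub>m n) (- A) (0\<^sub>m m n) (t \<cdot>\<^sub>m 1\<^sub>m m)"
  have carr: "M \<in> carrier_mat (n + m) (n + m)" "L \<in> carrier_mat (n + m) (n + m)"
    "R \<in> carrier_mat (n + m) (n + m)"
    using A B by (auto simp: M_def L_def R_def)
  have prod_L: "M * L = four_block_mat (t \<cdot>\<^sub>m 1\<^sub>m n - A * B) A (0\<^sub>m m n) (1\<^sub>m m)"
    unfolding M_def L_def using A B
    by (subst mult_four_block_mat[of _ n n _ m _ m])
       (auto intro!: cong_four_block_mat eq_matI)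
  have scal: "t \<cdot>\<^sub>m 1\<^sub>m k \<in> carrier_mat k k" for k by simp
  have neg: "- A \<in> carrier_mat n m" using A by simp
  have blocks: "t \<cdot>\<^sub>m 1\<^sub>m n * 1\<^sub>m n + A * 0\<^sub>m m n = t \<cdot>\<^sub>m 1\<^sub>m n"
    "B * 1\<^sub>m n + 1\<^sub>m m * 0\<^sub>m m n = B"
    using A B by simp_all
  have block_zero: "t \<cdot>\<^sub>m 1\<^sub>m n * (- A) + A * (t \<cdot>\<^sub>m 1\<^sub>m m) = 0\<^sub>m n m"
    unfolding mult_smult_assoc_mat[OF one_carrier_mat neg] mult_smult_distrib[OF A one_carrier_mat]
    using A neg by (auto intro!: eq_matI)
  have block_det: "B * (- A) + 1\<^sub>m m * (t \<cdot>\<^sub>m 1\<^sub>m m) = t \<cdot>\<^sub>m 1\<^sub>m m - B * A"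
    using A B by (auto intro!: eq_matI)
  have prod_R: "M * R = four_block_mat (t \<cdot>\<^sub>m 1\<^sub>m n) (0\<^sub>m n m) B (t \<cdot>\<^sub>m 1\<^sub>m m - B * A)"
    unfolding M_def R_def
      mult_four_block_mat[OF scal A B one_carrier_mat one_carrier_mat neg zero_carrier_mat scal]
      blocks block_zero block_det ..
  have "det L = 1"
    unfolding L_def using B by (subst det_four_block_mat_upper_right_zero[of _ n _ m]) auto
  moreover have "det R = t ^ m"
    unfolding R_def using A by (subst det_four_block_mat_lower_left_zero[of _ n _ m]) auto
  moreover have "det M * det L = det (t \<cdot>\<^sub>m 1\<^sub>m n - A * B)"
    unfolding det_mult[OF carr(1,2), symmetric] prod_L
    using A B by (subst det_four_block_mat_lower_left_zero[of _ n _ m]) auto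
  moreover have "det M * det R = t ^ n * det (t \<cdot>\<^sub>m 1\<^sub>m m - B * A)"
    unfolding det_mult[OF carr(1,3), symmetric] prod_R
    using A B by (subst det_four_block_mat_upper_right_zero[of _ n _ m]) auto
  ultimately show ?thesis by (simp add: mult.commute)
qed

lemma real_poly_eqI_except:
  fixes p q :: "real poly"
  assumes "\<And>t. t \<noteq> a \<Longrightarrow> poly p t = poly q t"
  shows "p = q"
proof -
  have "poly ([:- a, 1:] * p) = poly ([:- a, 1:] * q)"
  proof
    fix t show "poly ([:- a, 1:] * p) t = poly ([:- a, 1:] * q) t"
      using assms[of t] by (cases "t = a") simp_all
  qed
  then have "[:- a, 1:] * p = [:- a, 1:] * q" by (simp only: poly_eq_poly_eq_iff)
  then show ?thesis by (simp only: mult_cancel_left) simp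
qed

lemma char_poly_mult_commute:
  fixes A B :: "real mat"
  assumes A: "A \<in> carrier_mat n m" and B: "B \<in> carrier_mat m n"
  shows "monom 1 m * char_poly (A * B) = monom 1 n * char_poly (B * A)"
  using A B det_mult_commute[OF A B]
  by (intro real_poly_eqI_except) (simp add: poly_monom poly_char_poly[of _ n] poly_char_poly[of _ m])

text \<open>
  Brauer's rank-one deflation: subtracting \<open>k v w\<^sup>T\<close> moves the eigenvalue \<open>k\<close> of \<open>v\<close> to 0 and leaves
  the rest of the spectrum alone. The reason is the factorization
  \<open>(t - k) (t I - A') = (t I - A) ((t - k) I + k v w\<^sup>T)\<close>, whose last factor has a determinant that
  Sylvester's identity reduces to size 1. Comparing multiplicities of both sides as polynomials
  controls algebraic multiplicities, and not only eigenspaces.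
\<close>

lemma char_poly_deflation:
  fixes A :: "real mat"
  assumes A: "A \<in> carrier_mat n n" and v: "v \<in> carrier_vec n" and w: "w \<in> carrier_vec n"
    and Av: "A *\<^sub>v v = k \<cdot>\<^sub>v v" and wv: "w \<bullet> v = 1"
  defines "A' \<equiv> mat n n (\<lambda>(i, j). A $$ (i, j) - k * v $ i * w $ j)"
  shows "[:- k, 1:] * char_poly A' = [:0, 1:] * char_poly A"
proof -
  define V where "V = mat n 1 (\<lambda>(i, j). - k * v $ i)"
  define W where "W = mat 1 n (\<lambda>(i, j). w $ j)"
  have carr: "V \<in> carrier_mat n 1" "W \<in> carrier_mat 1 n" "A' \<in> carrier_mat n n"
    by (simp_all add: V_def W_def A'_def)
  have WV: "W * V = - k \<cdot>\<^sub>m 1\<^sub>m 1"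
  proof (rule eq_matI)
    fix i j assume "i < dim_row (- k \<cdot>\<^sub>m 1\<^sub>m 1)" "j < dim_col (- k \<cdot>\<^sub>m 1\<^sub>m 1 :: real mat)"
    then have ij: "i = 0" "j = 0" by auto
    have "(W * V) $$ (0, 0) = - k * (w \<bullet> v)"
      using v w by (simp add: W_def V_def scalar_prod_def sum_distrib_left mult_ac)
    then show "(W * V) $$ (i, j) = (- k \<cdot>\<^sub>m 1\<^sub>m 1) $$ (i, j)"
      using ij wv by simp
  qed (simp_all add: W_def V_def)
  have Avi: "(\<Sum>l = 0..<n. A $$ (i, l) * v $ l) = k * v $ i" if "i < n" for i
    using arg_cong[OF Av, of "\<lambda>x. x $ i"] that A v by (simp add: scalar_prod_def)
  have eq: "(t - k) * poly (char_poly A') t = t * poly (char_poly A) t" if "t \<noteq> k" for t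
  proof -
    have prod: "(t - k) \<cdot>\<^sub>m (t \<cdot>\<^sub>m 1\<^sub>m n - A') = (t \<cdot>\<^sub>m 1\<^sub>m n - A) * ((t - k) \<cdot>\<^sub>m 1\<^sub>m n - V * W)"
      (is "?L = ?R")
    proof (rule eq_matI)
      fix i j assume "i < dim_row ?R" "j < dim_col ?R"
      then have ij: "i < n" "j < n" using A carr by auto
      have delta: "(\<Sum>l = 0..<n. of_bool (a = l) * g l) = g a"
        "(\<Sum>l = 0..<n. g l * of_bool (l = a)) = g a"
        if "a < n" for a and g :: "nat \<Rightarrow> real"
      proof -
        have "{0..<n} \<inter> {l. a = l} = {a}" "{0..<n} \<inter> {l. l = a} = {a}" using that by auto
        then show "(\<Sum>l = 0..<n. of_bool (a = l) * g l) = g a"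
          "(\<Sum>l = 0..<n. g l * of_bool (l = a)) = g a"
          by (simp_all only: sum_mult_of_bool_eq sum_of_bool_mult_eq finite_atLeastLessThan) simp_all
      qed
      have "?R $$ (i, j) = (\<Sum>l = 0..<n. (t * of_bool (i = l) - A $$ (i, l)) *
          ((t - k) * of_bool (l = j) + k * v $ l * w $ j))"
        using ij A by (auto simp: scalar_prod_def V_def W_def of_bool_def intro!: sum.cong)
      also have "\<dots> = (\<Sum>l = 0..<n. of_bool (i = l) * (t * (t - k) * of_bool (l = j)))
           + (\<Sum>l = 0..<n. of_bool (i = l) * (t * k * v $ l * w $ j))
           - (\<Sum>l = 0..<n. A $$ (i, l) * (t - k) * of_bool (l = j))
           - k * w $ j * (\<Sum>l = 0..<n. A $$ (i, l) * v $ l)"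
        unfolding sum_distrib_left sum.distrib[symmetric] sum_subtractf[symmetric]
        by (intro sum.cong) (auto simp: algebra_simps)
      also have "\<dots> = t * (t - k) * of_bool (i = j) + t * k * v $ i * w $ j
          - A $$ (i, j) * (t - k) - k * w $ j * (k * v $ i)"
        unfolding Avi[OF ij(1)] delta(1)[OF ij(1)] delta(2)[OF ij(2)] ..
      also have "\<dots> = ?L $$ (i, j)"
        using ij A by (auto simp: A'_def algebra_simps)
      finally show "?L $$ (i, j) = ?R $$ (i, j)" by simp
    qed (use A carr in auto)
    have "(t - k) ^ n * poly (char_poly A') t = det ?L"
      unfolding poly_char_poly[OF carr(3)] using carr by simp
    also have "\<dots> = poly (char_poly A) t * det ((t - k) \<cdot>\<^sub>m 1\<^sub>m n - V * W)"
      unfolding prod poly_char_poly[OF A] using A carr by (intro det_mult) auto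
    finally have 1: "(t - k) ^ n * poly (char_poly A') t = poly (char_poly A) t * det ((t - k) \<cdot>\<^sub>m 1\<^sub>m n - V * W)" .
    have "(t - k) \<cdot>\<^sub>m 1\<^sub>m 1 - W * V = t \<cdot>\<^sub>m 1\<^sub>m 1"
      unfolding WV by (intro eq_matI) auto
    then have 2: "(t - k) * det ((t - k) \<cdot>\<^sub>m 1\<^sub>m n - V * W) = (t - k) ^ n * t"
      using det_mult_commute[OF carr(1,2), of "t - k"] by simp
    have "(t - k) ^ n * ((t - k) * poly (char_poly A') t)
        = (t - k) * (poly (char_poly A) t * det ((t - k) \<cdot>\<^sub>m 1\<^sub>m n - V * W))"
      by (simp only: 1[symmetric] mult.left_commute)
    also have "\<dots> = poly (char_poly A) t * ((t - k) ^ n * t)"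
      by (simp only: 2[symmetric] mult.left_commute)
    also have "\<dots> = (t - k) ^ n * (t * poly (char_poly A) t)"
      by (simp only: mult_ac)
    finally have "(t - k) ^ n * ((t - k) * poly (char_poly A') t) = (t - k) ^ n * (t * poly (char_poly A) t)" .
    then show ?thesis using that by simp
  qed
  show ?thesis
    by (rule real_poly_eqI_except[where a = k]) (use eq in \<open>simp add: algebra_simps\<close>)
qed

section \<open>The distance matrix of a path\<close>

lemma mat_mult_mat:
  "mat n k f * mat k m g = mat n m (\<lambda>(i, j). \<Sum>l<k. f (i, l) * g (l, j))"
  by (rule eq_matI) (auto simp: scalar_prod_def atLeast0LessThan)

lemma sum_of_bool_Suc_le:
  assumes "j \<le> m"
  shows "(\<Sum>l<m. of_bool (Suc l \<le> j)) = real j"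
proof -
  have "(\<Sum>l<m. of_bool (Suc l \<le> j)) = (\<Sum>l<j. 1 :: real)"
    using assms by (intro sum.mono_neutral_cong_right) auto
  then show ?thesis by simp
qed

text \<open>
  The minimum of \<open>a\<close> and \<open>b\<close> counts the thresholds \<open>1, \<dots>, m\<close> below both; written as a sum of products,
  it exhibits the distance as a rank-two form minus a positive semidefinite one.
\<close>

lemma abs_diff_via_thresholds:
  assumes "a \<le> m" "b \<le> m"
  shows "\<bar>real a - real b\<bar> = real a + real b
    - 2 * (\<Sum>l<m. of_bool (Suc l \<le> a) * of_bool (Suc l \<le> b))"
proof -
  have "(\<Sum>l<m. of_bool (Suc l \<le> a) * of_bool (Suc l \<le> b)) = (\<Sum>l<m. of_bool (Suc l \<le> min a b) :: real)"
    by (intro sum.cong) auto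
  also have "\<dots> = real (min a b)" by (rule sum_of_bool_Suc_le) (use assms in auto)
  finally show ?thesis by simp
qed

definition path_distance_matrix :: "nat \<Rightarrow> real mat" where
  "path_distance_matrix m = mat (Suc m) (Suc m) (\<lambda>(i, j). \<bar>real i - real j\<bar>)"

text \<open>
  With the threshold matrix \<open>S\<close>, the distance matrix is \<open>S K S\<^sup>T\<close> for the arrow matrix \<open>K\<close> that has
  \<open>0\<close> in the corner, ones in the rest of the first row and column, and \<open>-2\<close> on the rest of the
  diagonal. Adding half of the other columns of \<open>K\<close> to its first one makes it upper triangular.
\<close>

lemma det_path_distance_matrix: "det (path_distance_matrix m) = real m / 2 * (- 2) ^ m"
proof -
  define S where "S = mat (Suc m) (Suc m) (\<lambda>(i, j). of_bool (j \<le> i) :: real)"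
  \<comment> \<open>In terms of the arrow matrix \<open>K\<close>: \<open>R = S K\<close> and \<open>U = K H\<close>, where \<open>H\<close> is the column operation.\<close>
  define R where "R = mat (Suc m) (Suc m) (\<lambda>(i, j). if j = 0 then real i else 1 - 2 * of_bool (j \<le> i))"
  define H where "H = mat (Suc m) (Suc m) (\<lambda>(i, j). if j = i then 1 else if j = 0 then 1 / 2 else 0 :: real)"
  define U where "U = mat (Suc m) (Suc m)
    (\<lambda>(i, j). if i = 0 then (if j = 0 then real m / 2 else 1) else if j = i then - 2 else 0)"
  have carr: "S \<in> carrier_mat (Suc m) (Suc m)" "R \<in> carrier_mat (Suc m) (Suc m)"
    "H \<in> carrier_mat (Suc m) (Suc m)" "U \<in> carrier_mat (Suc m) (Suc m)"
    by (simp_all add: S_def R_def H_def U_def)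
  have [simp]: "det S = 1"
    by (subst det_lower_triangular[OF _ carr(1)])
       (auto simp: S_def prod_list_diag_prod)
  have [simp]: "det H = 1"
    by (subst det_lower_triangular[OF _ carr(3)])
       (auto simp: H_def prod_list_diag_prod)
  have detU: "det U = real m / 2 * (- 2) ^ m"
    by (subst det_upper_triangular[OF _ carr(4)])
       (auto simp: U_def prod_list_diag_prod upper_triangular_def prod.atLeast0_lessThan_Suc_shift
         simp del: prod.op_ivl_Suc)
  have ST: "transpose_mat S = mat (Suc m) (Suc m) (\<lambda>(i, j). of_bool (i \<le> j))"
    by (rule eq_matI) (auto simp: S_def)
  have "(\<Sum>l<Suc m. (if l = 0 then real i else 1 - 2 * of_bool (l \<le> i)) * of_bool (l \<le> j))
      = \<bar>real i - real j\<bar>" if "i < Suc m" "j < Suc m" for i j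
  proof -
    have "(\<Sum>l<Suc m. (if l = 0 then real i else 1 - 2 * of_bool (l \<le> i)) * of_bool (l \<le> j))
       = real i + ((\<Sum>l<m. of_bool (Suc l \<le> j)) - 2 * (\<Sum>l<m. of_bool (Suc l \<le> i) * of_bool (Suc l \<le> j)))"
      unfolding sum.lessThan_Suc_shift sum_distrib_left sum_subtractf[symmetric]
      by (simp add: left_diff_distrib mult.assoc del: of_bool_conj flip: of_bool_conj)
    then show ?thesis
      using that abs_diff_via_thresholds[of i m j] sum_of_bool_Suc_le[of j m] by simp
  qed
  then have "path_distance_matrix m = R * transpose_mat S"
    unfolding ST path_distance_matrix_def R_def mat_mult_mat by (intro cong_mat) simp_all
  then have "det (path_distance_matrix m) = det R * det (transpose_mat S)"
    using carr by (simp add: det_mult)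
  then have "det (path_distance_matrix m) = det R" using carr by (simp add: det_transpose)
  moreover have "(\<Sum>l<Suc m. (if l = 0 then real i else 1 - 2 * of_bool (l \<le> i))
        * (if j = l then 1 else if j = 0 then 1 / 2 else 0))
      = (\<Sum>l<Suc m. of_bool (l \<le> i)
        * (if l = 0 then if j = 0 then real m / 2 else 1 else if j = l then - 2 else 0))"
    if "i < Suc m" "j < Suc m" for i j
  proof (cases j)
    case 0
    have "(\<Sum>l<m. (1 - 2 * of_bool (Suc l \<le> i)) / 2) = real m / 2 - (\<Sum>l<m. of_bool (Suc l \<le> i))"
      by (simp add: sum_subtractf diff_divide_distrib)
    then show ?thesis using 0 that sum_of_bool_Suc_le[of i m]
      unfolding sum.lessThan_Suc_shift by simp
  next
    case (Suc j')
    then show ?thesis using that unfolding sum.lessThan_Suc_shift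
      by (simp add: if_distrib cong: if_cong)
  qed
  then have "R * H = S * U"
    unfolding R_def H_def S_def U_def mat_mult_mat by (intro cong_mat) simp_all
  then have "det R * det H = det S * det U"
    using carr by (metis det_mult)
  ultimately show ?thesis using detU by simp
qed



section \<open>Symmetric forms that are nonpositive on a hyperplane\<close>

lemma scalar_prod_self_pos:
  fixes v :: "real vec"
  assumes "v \<in> carrier_vec n" "v \<noteq> 0\<^sub>v n"
  shows "v \<bullet> v > 0"
proof -
  obtain i where i: "i < n" "v $ i \<noteq> 0"
    using assms by (metis carrier_vecD eq_vecI index_zero_vec(1,2))
  have "v \<bullet> v = (\<Sum>i = 0..<n. (v $ i)\<^sup>2)"
    using assms(1) by (simp add: scalar_prod_def power2_eq_square)
  also have "\<dots> > 0" by (rule sum_pos2[of _ i]) (use i in auto)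
  finally show ?thesis .
qed

text \<open>
  The form is positive on the whole plane spanned by the two eigenvectors, and this plane contains a
  nonzero vector orthogonal to \<open>u\<close>.
\<close>

lemma no_orthogonal_positive_eigenvectors:
  fixes A :: "real mat"
  assumes A: "A \<in> carrier_mat n n" and u: "u \<in> carrier_vec n"
    and nonpos: "\<And>x. x \<in> carrier_vec n \<Longrightarrow> u \<bullet> x = 0 \<Longrightarrow> x \<bullet> (A *\<^sub>v x) \<le> 0"
    and v: "eigenvector A v k" "k > 0" and w: "eigenvector A w l" "l > 0"
    and orth: "v \<bullet> w = 0"
  shows False
proof -
  have vn: "v \<in> carrier_vec n" "v \<noteq> 0\<^sub>v n" "A *\<^sub>v v = k \<cdot>\<^sub>v v"
    and wn: "w \<in> carrier_vec n" "w \<noteq> 0\<^sub>v n" "A *\<^sub>v w = l \<cdot>\<^sub>v w"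
    using v(1) w(1) A unfolding eigenvector_def by auto
  have pos: "v \<bullet> v > 0" "w \<bullet> w > 0" using scalar_prod_self_pos vn wn by auto
  have orth': "w \<bullet> v = 0" using orth comm_scalar_prod[OF vn(1) wn(1)] by simp
  define a b where "a = u \<bullet> w" and "b = u \<bullet> v"
  show False
  proof (cases "b = 0")
    case True
    then have "v \<bullet> (A *\<^sub>v v) \<le> 0" using nonpos[OF vn(1)] by (simp add: b_def)
    then show False using vn pos v(2) by (simp add: mult_le_0_iff)
  next
    case False
    define x where "x = a \<cdot>\<^sub>v v - b \<cdot>\<^sub>v w"
    have x: "x \<in> carrier_vec n" using vn wn by (simp add: x_def)
    have "u \<bullet> x = a * (u \<bullet> v) - b * (u \<bullet> w)"
      unfolding x_def using u vn(1) wn(1) by (simp add: scalar_prod_minus_distrib[of _ n])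
    then have "u \<bullet> x = 0" by (simp add: a_def b_def)
    then have le: "x \<bullet> (A *\<^sub>v x) \<le> 0" using nonpos[OF x] by simp
    have Ax: "A *\<^sub>v x = a \<cdot>\<^sub>v (k \<cdot>\<^sub>v v) - b \<cdot>\<^sub>v (l \<cdot>\<^sub>v w)"
      unfolding x_def using A vn wn
      by (simp add: mult_minus_distrib_mat_vec[of _ n n] mult_mat_vec[of _ n n])
    have "x \<bullet> (A *\<^sub>v x) = a\<^sup>2 * k * (v \<bullet> v) + b\<^sup>2 * l * (w \<bullet> w)"
      unfolding Ax unfolding x_def using vn(1) wn(1)
      by (simp add: scalar_prod_minus_distrib[of _ n] minus_scalar_prod_distrib[of _ n]
          orth orth' power2_eq_square)
    moreover have "b\<^sup>2 * l * (w \<bullet> w) > 0" using False w(2) pos(2) by simp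
    moreover have "a\<^sup>2 * k * (v \<bullet> v) \<ge> 0" using v(2) pos(1) by simp
    ultimately show False using le by linarith
  qed
qed

text \<open>
  Deflating \<open>k\<close> along a normalized eigenvector leaves no positive root: by symmetry, an eigenvector
  of the deflated matrix for a nonzero eigenvalue is orthogonal to the deflated direction, so that it
  would be a second, orthogonal eigenvector of \<open>A\<close> with a positive eigenvalue.
\<close>

lemma order_positive_eigenvalue:
  fixes A :: "real mat"
  assumes A: "A \<in> carrier_mat n n" and sym: "transpose_mat A = A" and u: "u \<in> carrier_vec n"
    and nonpos: "\<And>x. x \<in> carrier_vec n \<Longrightarrow> u \<bullet> x = 0 \<Longrightarrow> x \<bullet> (A *\<^sub>v x) \<le> 0"
    and k: "eigenvalue A k" "k > 0" and "y > 0"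
  shows "Polynomial.order y (char_poly A) = of_bool (y = k)"
proof -
  obtain v where ev: "eigenvector A v k" using k(1) by (auto simp: eigenvalue_def)
  then have v: "v \<in> carrier_vec n" "v \<noteq> 0\<^sub>v n" "A *\<^sub>v v = k \<cdot>\<^sub>v v"
    using A unfolding eigenvector_def by auto
  have vv: "v \<bullet> v > 0" using scalar_prod_self_pos v by auto
  define w where "w = (1 / (v \<bullet> v)) \<cdot>\<^sub>v v"
  have w: "w \<in> carrier_vec n" "w \<bullet> v = 1" using v vv by (simp_all add: w_def)
  define A' where "A' = mat n n (\<lambda>(i, j). A $$ (i, j) - k * v $ i * w $ j)"
  have A': "A' \<in> carrier_mat n n" by (simp add: A'_def)
  have A'x: "A' *\<^sub>v x = A *\<^sub>v x - (k * (w \<bullet> x)) \<cdot>\<^sub>v v" if "x \<in> carrier_vec n" for x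
    using that A v w
    by (intro eq_vecI) (auto simp: A'_def scalar_prod_def sum_subtractf sum_distrib_left algebra_simps)
  have eq: "[:- k, 1:] * char_poly A' = [:0, 1:] * char_poly A"
    unfolding A'_def by (rule char_poly_deflation[OF A v(1) w(1) v(3) w(2)])
  have no_root: "poly (char_poly A') y \<noteq> 0"
  proof
    assume "poly (char_poly A') y = 0"
    then obtain x where "eigenvector A' x y"
      using eigenvalue_root_char_poly[OF A'] by (auto simp: eigenvalue_def)
    then have x: "x \<in> carrier_vec n" "x \<noteq> 0\<^sub>v n" "A' *\<^sub>v x = y \<cdot>\<^sub>v x"
      using A' unfolding eigenvector_def by auto
    have wx: "w \<bullet> x = (v \<bullet> x) / (v \<bullet> v)" using v x by (simp add: w_def)
    have "v \<bullet> (A *\<^sub>v x) = k * (v \<bullet> x)"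
      using transpose_vec_mult_scalar[OF A x(1) v(1)] sym v x by simp
    then have "v \<bullet> (A' *\<^sub>v x) = 0"
      unfolding A'x[OF x(1)] wx using A v x vv by (simp add: scalar_prod_minus_distrib[of _ n])
    then have vx: "v \<bullet> x = 0" using x v \<open>y > 0\<close> by simp
    then have "A *\<^sub>v x = y \<cdot>\<^sub>v x"
      using A'x[OF x(1)] x A v unfolding wx by (auto intro!: eq_vecI simp: vec_eq_iff)
    then have "eigenvector A x y" using x A unfolding eigenvector_def by auto
    from no_orthogonal_positive_eigenvectors[OF A u nonpos ev k(2) this \<open>y > 0\<close> vx]
    show False .
  qed
  have nz: "char_poly A \<noteq> 0" "char_poly A' \<noteq> 0"
    using degree_monic_char_poly[OF A] degree_monic_char_poly[OF A'] by auto
  have nonzero: "[:- k, 1:] * char_poly A' \<noteq> 0" "[:0, 1:] * char_poly A \<noteq> 0"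
    using nz by (auto simp only: mult_eq_0_iff pCons_eq_0_iff)
  have "Polynomial.order y ([:- k, 1:] * char_poly A') = Polynomial.order y ([:0, 1:] * char_poly A)"
    by (simp only: eq)
  then have "Polynomial.order y [:- k, 1:] + Polynomial.order y (char_poly A')
      = Polynomial.order y [:0, 1:] + Polynomial.order y (char_poly A)"
    by (simp only: order_mult[OF nonzero(1)] order_mult[OF nonzero(2)])
  moreover have "Polynomial.order y (char_poly A') = 0" using no_root by (rule order_0I)
  moreover have "Polynomial.order y [:0, 1:] = 0" using \<open>y > 0\<close> by (intro order_0I) simp
  moreover have "Polynomial.order y [:- k, 1:] = of_bool (y = k)"
    using order_power_n_n[of k 1] order_0I[of "[:- k, 1:]" y] by auto
  ultimately show ?thesis by simp
qed

lemma sum_positive_eigenvalue_orders: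
  fixes A :: "real mat"
  assumes A: "A \<in> carrier_mat n n" and sym: "transpose_mat A = A" and u: "u \<in> carrier_vec n"
    and nonpos: "\<And>x. x \<in> carrier_vec n \<Longrightarrow> u \<bullet> x = 0 \<Longrightarrow> x \<bullet> (A *\<^sub>v x) \<le> 0"
    and k: "eigenvalue A k" "k > 0"
  shows "(\<Sum>y | eigenvalue A y \<and> y > 0. Polynomial.order y (char_poly A)) = 1"
proof -
  have ord: "Polynomial.order y (char_poly A) = of_bool (y = k)" if "y > 0" for y
    by (rule order_positive_eigenvalue[OF A sym u _ k that]) (rule nonpos)
  have "char_poly A \<noteq> 0" using degree_monic_char_poly[OF A] by auto
  then have "eigenvalue A y \<and> y > 0 \<longleftrightarrow> y = k" for y
    using ord[of y] k eigenvalue_root_char_poly[OF A, of y] order_root[of "char_poly A" y] by auto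
  then have "{y. eigenvalue A y \<and> y > 0} = {k}" by auto
  then show ?thesis using ord[OF k(2)] by simp
qed

section \<open>The spectrum of a distance matrix on a line\<close>

context
  fixes f :: "nat \<Rightarrow> nat" and n m :: nat and A :: "real mat"
  assumes image: "f ` {..<n} = {..m}"
  defines "A \<equiv> mat n n (\<lambda>(i, j). \<bar>real (f i) - real (f j)\<bar>)"
begin

text \<open>
  On vectors with coordinate sum 0 the rank-two part of the distance form vanishes, and what is left
  is \<open>-2\<close> times a sum of squares, one for each threshold.
\<close>

lemma distance_matrix_nonpos:
  assumes x: "x \<in> carrier_vec n" and sum0: "vec n (\<lambda>_. 1) \<bullet> x = 0"
  shows "x \<bullet> (A *\<^sub>v x) \<le> 0"
proof -
  have f: "f i \<le> m" if "i < n" for i using image that by auto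
  have x0: "(\<Sum>i<n. x $ i) = 0"
    using sum0 x by (simp add: scalar_prod_def atLeast0LessThan)
  define s where "s l = (\<Sum>i<n. x $ i * of_bool (Suc l \<le> f i))" for l
  have "x \<bullet> (A *\<^sub>v x) = (\<Sum>i<n. \<Sum>j<n. x $ i * x $ j * \<bar>real (f i) - real (f j)\<bar>)"
    using x by (simp add: A_def scalar_prod_def atLeast0LessThan sum_distrib_left mult_ac)
  also have "\<dots> = (\<Sum>i<n. \<Sum>j<n. x $ i * real (f i) * x $ j + x $ i * (x $ j * real (f j))
      - 2 * (\<Sum>l<m. (x $ i * of_bool (Suc l \<le> f i)) * (x $ j * of_bool (Suc l \<le> f j))))"
  proof (intro sum.cong refl)
    fix i j assume "i \<in> {..<n}" "j \<in> {..<n}"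
    then have "f i \<le> m" "f j \<le> m" using f by auto
    note dist = abs_diff_via_thresholds[OF this]
    have "x $ i * x $ j * \<bar>real (f i) - real (f j)\<bar> = x $ i * real (f i) * x $ j + x $ i * (x $ j * real (f j))
        - 2 * (x $ i * x $ j * (\<Sum>l<m. of_bool (Suc l \<le> f i) * of_bool (Suc l \<le> f j)))"
      unfolding dist by (simp only: algebra_simps)
    also have "x $ i * x $ j * (\<Sum>l<m. of_bool (Suc l \<le> f i) * of_bool (Suc l \<le> f j))
        = (\<Sum>l<m. (x $ i * of_bool (Suc l \<le> f i)) * (x $ j * of_bool (Suc l \<le> f j)))"
      unfolding sum_distrib_left by (intro sum.cong refl) (simp only: mult_ac)
    finally show "x $ i * x $ j * \<bar>real (f i) - real (f j)\<bar> = x $ i * real (f i) * x $ j + x $ i * (x $ j * real (f j))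
      - 2 * (\<Sum>l<m. (x $ i * of_bool (Suc l \<le> f i)) * (x $ j * of_bool (Suc l \<le> f j)))" .
  qed
  also have "\<dots> = (\<Sum>i<n. x $ i * real (f i)) * (\<Sum>j<n. x $ j) + (\<Sum>i<n. x $ i) * (\<Sum>j<n. x $ j * real (f j))
      - 2 * (\<Sum>i<n. \<Sum>j<n. \<Sum>l<m. (x $ i * of_bool (Suc l \<le> f i)) * (x $ j * of_bool (Suc l \<le> f j)))"
    by (simp only: sum_subtractf sum.distrib sum_product) (simp only: sum_distrib_left)
  also have "(\<Sum>i<n. \<Sum>j<n. \<Sum>l<m. (x $ i * of_bool (Suc l \<le> f i)) * (x $ j * of_bool (Suc l \<le> f j)))
      = (\<Sum>l<m. (s l)\<^sup>2)"
  proof -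
    have "(\<Sum>l<m. (s l)\<^sup>2) = (\<Sum>l<m. \<Sum>i<n. \<Sum>j<n. (x $ i * of_bool (Suc l \<le> f i)) * (x $ j * of_bool (Suc l \<le> f j)))"
      unfolding s_def power2_eq_square sum_product ..
    also have "\<dots> = (\<Sum>i<n. \<Sum>l<m. \<Sum>j<n. (x $ i * of_bool (Suc l \<le> f i)) * (x $ j * of_bool (Suc l \<le> f j)))"
      by (rule sum.swap)
    also have "\<dots> = (\<Sum>i<n. \<Sum>j<n. \<Sum>l<m. (x $ i * of_bool (Suc l \<le> f i)) * (x $ j * of_bool (Suc l \<le> f j)))"
      by (intro sum.cong refl sum.swap)
    finally show ?thesis ..
  qed
  finally have "x \<bullet> (A *\<^sub>v x) = - 2 * (\<Sum>l<m. (s l)\<^sup>2)" by (simp add: x0)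
  moreover have "(\<Sum>l<m. (s l)\<^sup>2) \<ge> 0" by (intro sum_nonneg) simp
  ultimately show ?thesis by simp
qed

text \<open>
  Grouping equal values of \<open>f\<close> reduces \<open>A\<close> to a square matrix of size \<open>m + 1\<close>, namely the path distance
  matrix weighted by the fibre sizes. For \<open>m > 0\<close> it is nonsingular, and its characteristic polynomial
  \<open>q\<close> at 0 has the sign of \<open>(-1)\<^bsup>m+1\<^esup> (-2)\<^sup>m\<close>, which is negative for every \<open>m\<close>.
\<close>

lemma distance_matrix_char_poly:
  assumes "m > 0"
  obtains q where "monom 1 (Suc m) * char_poly A = monom 1 n * q" "lead_coeff q > 0" "poly q 0 < 0"
proof -
  define B where "B = mat n (Suc m) (\<lambda>(i, k). of_bool (f i = k) :: real)"
  define C where "C = mat (Suc m) n (\<lambda>(k, j). \<bar>real k - real (f j)\<bar>)"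
  define c where "c k = real (card {i. i < n \<and> f i = k})" for k
  define N where "N = mat (Suc m) (Suc m) (\<lambda>(k, l). if k = l then c k else 0)"
  have carr: "B \<in> carrier_mat n (Suc m)" "C \<in> carrier_mat (Suc m) n"
    "N \<in> carrier_mat (Suc m) (Suc m)" "path_distance_matrix m \<in> carrier_mat (Suc m) (Suc m)"
    by (simp_all add: B_def C_def N_def path_distance_matrix_def)
  have f: "f i < Suc m" if "i < n" for i using image that by (auto simp: less_Suc_eq_le)
  have "(\<Sum>k<Suc m. of_bool (f i = k) * \<bar>real k - real (f j)\<bar>) = \<bar>real (f i) - real (f j)\<bar>" if "i < n" for i j
  proof -
    have "{..<Suc m} \<inter> {k. f i = k} = {f i}" using f[OF that] by auto
    then show ?thesis by (simp only: sum_of_bool_mult_eq finite_lessThan) simp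
  qed
  then have BC: "B * C = A"
    unfolding B_def C_def A_def mat_mult_mat by (intro cong_mat) simp_all
  have "(\<Sum>i<n. \<bar>real k - real (f i)\<bar> * of_bool (f i = l)) = (\<Sum>j<Suc m. \<bar>real k - real j\<bar> * (if j = l then c j else 0))"
    if "l < Suc m" for k l
  proof -
    have "(\<Sum>i<n. \<bar>real k - real (f i)\<bar> * of_bool (f i = l)) = (\<Sum>i<n. \<bar>real k - real l\<bar> * of_bool (f i = l))"
      by (intro sum.cong) auto
    also have "\<dots> = (\<Sum>i\<in>{..<n} \<inter> {i. f i = l}. \<bar>real k - real l\<bar>)"
      by (simp only: sum_mult_of_bool_eq finite_lessThan)
    also have "{..<n} \<inter> {i. f i = l} = {i. i < n \<and> f i = l}" by auto
    also have "(\<Sum>i | i < n \<and> f i = l. \<bar>real k - real l\<bar>) = \<bar>real k - real l\<bar> * c l"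
      by (simp add: c_def)
    also have "\<dots> = (\<Sum>j<Suc m. if j = l then \<bar>real k - real l\<bar> * c l else 0)"
      using that by (subst sum.delta) auto
    also have "\<dots> = (\<Sum>j<Suc m. \<bar>real k - real j\<bar> * (if j = l then c j else 0))"
      by (intro sum.cong) auto
    finally show ?thesis .
  qed
  then have CB: "C * B = path_distance_matrix m * N"
    unfolding B_def C_def N_def path_distance_matrix_def mat_mult_mat by (intro cong_mat) simp_all
  have "c k > 0" if "k < Suc m" for k
  proof -
    have "k \<in> f ` {..<n}" using that image by auto
    then show ?thesis unfolding c_def by (auto simp: card_gt_0_iff)
  qed
  then have "(\<Prod>k = 0..<Suc m. c k) > 0" by (intro prod_pos) simp
  moreover have "det N = (\<Prod>k = 0..<Suc m. c k)"
    by (subst det_upper_triangular[OF _ carr(3)])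
       (auto simp: N_def prod_list_diag_prod upper_triangular_def simp del: prod.op_ivl_Suc)
  ultimately have N: "det N > 0" by simp
  have "poly (char_poly (C * B)) 0 = det (- 1 \<cdot>\<^sub>m (path_distance_matrix m * N))"
  proof -
    have "0 \<cdot>\<^sub>m 1\<^sub>m (Suc m) - path_distance_matrix m * N = - 1 \<cdot>\<^sub>m (path_distance_matrix m * N)"
      using carr by (intro eq_matI) auto
    then show ?thesis
      unfolding CB using carr by (subst poly_char_poly[of _ "Suc m"]) auto
  qed
  also have "\<dots> = (- 1) ^ Suc m * (real m / 2 * (- 2) ^ m * det N)"
    using carr by (simp add: det_mult[OF carr(4,3)] det_path_distance_matrix)
  also have "\<dots> = - (real m / 2 * 2 ^ m * det N)"
    by (simp add: power_minus[of 2])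
  also have "\<dots> < 0" using N assms by simp
  finally have "poly (char_poly (C * B)) 0 < 0" .
  moreover have "lead_coeff (char_poly (C * B)) > 0"
    using degree_monic_char_poly[of "C * B" "Suc m"] carr by simp
  moreover have "monom 1 (Suc m) * char_poly A = monom 1 n * char_poly (C * B)"
    using char_poly_mult_commute[OF carr(1,2)] unfolding BC .
  ultimately show ?thesis using that by blast
qed

lemma distance_matrix_order_0:
  assumes "m > 0"
  shows "Polynomial.order 0 (char_poly A) + Suc m = n"
proof -
  obtain q where q: "monom 1 (Suc m) * char_poly A = monom 1 n * q" "lead_coeff q > 0" "poly q 0 < 0"
    using distance_matrix_char_poly[OF assms] .
  have "A \<in> carrier_mat n n" by (simp add: A_def)
  then have "char_poly A \<noteq> 0" using degree_monic_char_poly by force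
  moreover have "q \<noteq> 0" "Polynomial.order 0 q = 0" using q(3) by (auto intro: order_0I)
  moreover have "Polynomial.order 0 (monom 1 (Suc m) * char_poly A) = Polynomial.order 0 (monom 1 n * q)"
    by (simp only: q(1))
  ultimately show ?thesis by (simp add: order_mult order_0_monom)
qed

lemma distance_matrix_positive_orders:
  assumes "m > 0"
  shows "(\<Sum>y | eigenvalue A y \<and> y > 0. Polynomial.order y (char_poly A)) = 1"
proof -
  obtain q where q: "monom 1 (Suc m) * char_poly A = monom 1 n * q" "lead_coeff q > 0" "poly q 0 < 0"
    using distance_matrix_char_poly[OF assms] .
  obtain z where z: "\<And>x. x \<ge> z \<Longrightarrow> poly q x \<ge> lead_coeff q"
    using poly_pinfty_gt_lc[OF q(2)] by blast
  have "0 < max 1 z" by simp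
  moreover have "poly q (max 1 z) > 0" using z[of "max 1 z"] q(2) by simp
  ultimately obtain k where k: "k > 0" "poly q k = 0"
    using poly_IVT_pos[of 0 "max 1 z" q] q(3) by blast
  have A: "A \<in> carrier_mat n n" by (simp add: A_def)
  have "poly (char_poly A) k = 0"
    using arg_cong[OF q(1), of "\<lambda>p. poly p k"] k by (simp add: poly_monom)
  then have ev: "eigenvalue A k" using eigenvalue_root_char_poly[OF A] by simp
  have sym: "transpose_mat A = A" by (rule eq_matI) (auto simp: A_def)
  show ?thesis
    by (rule sum_positive_eigenvalue_orders[OF A sym _ _ ev k(1), of "vec n (\<lambda>_. 1)"])
       (simp, rule distance_matrix_nonpos)
qed

end



section \<open>Levels in rooted graphs\<close>

context wf_digraph begin

lemma level_le_length:
  assumes "awalk r p v"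
  shows "level G r v \<le> length p"
  unfolding level_def dist_graph_def by (rule Least_le) (use assms in blast)

lemma shortest_awalk:
  assumes "awalk r p v"
  shows "\<exists>q. awalk r q v \<and> length q = level G r v"
  unfolding level_def dist_graph_def by (rule LeastI_ex) (use assms in blast)

text \<open>
  No level is skipped: the initial segment of length \<open>k\<close> of a shortest walk to a deepest vertex is
  itself a shortest walk, so it ends in a vertex of level \<open>k\<close>.
\<close>

lemma level_image:
  assumes "finite (verts G)" "r \<in> verts G"
    and reach: "\<And>v. v \<in> verts G \<Longrightarrow> \<exists>p. awalk r p v"
  shows "level G r ` verts G = {..max_level G r}"
proof
  show "level G r ` verts G \<subseteq> {..max_level G r}"
    unfolding max_level_def using assms(1) by auto
next
  have "max_level G r \<in> level G r ` verts G"
    unfolding max_level_def by (rule Max_in) (use assms in auto)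
  then obtain v where v: "v \<in> verts G" "level G r v = max_level G r"
    by force
  then obtain p where p: "awalk r p v" "length p = max_level G r"
    using reach shortest_awalk by metis
  show "{..max_level G r} \<subseteq> level G r ` verts G"
  proof
    fix k assume "k \<in> {..max_level G r}"
    then have k: "k \<le> length p" using p by simp
    define w where "w = awlast r (take k p)"
    have "awalk r (take k p @ drop k p) v" using p(1) by (simp only: append_take_drop_id)
    then have 1: "awalk r (take k p) w" and 2: "awalk w (drop k p) v"
      unfolding w_def by (simp_all only: awalk_append_iff)
    obtain q where q: "awalk r q w" "length q = level G r w"
      using shortest_awalk[OF 1] by blast
    have "awalk r (q @ drop k p) v" using q(1) 2 by (rule awalk_appendI)
    from level_le_length[OF this] have "k \<le> level G r w" using q p v k by simp
    moreover have "level G r w \<le> k" using level_le_length[OF 1] k by simp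
    ultimately have "k = level G r w" by simp
    moreover have "w \<in> verts G" using 1 by (rule awalk_last_in_verts)
    ultimately show "k \<in> level G r ` verts G" by blast
  qed
qed

lemma level_0_imp_root:
  assumes "awalk r p v" "level G r v = 0"
  shows "v = r"
  using shortest_awalk[OF assms(1)] assms(2) awalk_empty_ends by (metis length_0_conv)

lemma max_level_pos:
  assumes "finite (verts G)" "r \<in> verts G"
    and reach: "\<And>v. v \<in> verts G \<Longrightarrow> \<exists>p. awalk r p v"
    and "u \<in> verts G" "u \<noteq> r"
  shows "max_level G r > 0"
proof -
  obtain p where "awalk r p u" using reach[OF assms(4)] ..
  then have "level G r u \<noteq> 0" using level_0_imp_root[of r p u] assms(5) by metis
  moreover have "level G r u \<le> max_level G r"
    unfolding max_level_def using assms(1,4) by simp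
  ultimately show ?thesis by linarith
qed

lemma awalk_del_vert_mono:
  assumes "pre_digraph.awalk (del_vert u) r p v"
  shows "awalk r p v"
  using subgraph_awalk_imp_awalk[OF assms subgraph_del_vert] .

lemma awalk_in_del_vert:
  assumes "awalk r p w" "u \<notin> set (awalk_verts r p)"
  shows "pre_digraph.awalk (del_vert u) r p w"
  using assms
proof (induction p arbitrary: r)
  case Nil
  then show ?case by (auto simp: pre_digraph.awalk_def pre_digraph.cas.simps verts_del_vert)
next
  case (Cons e p)
  interpret H: wf_digraph "del_vert u" by (rule wf_digraph_del_vert)
  have "head G e \<in> set (awalk_verts (head G e) p)"
    by (rule hd_in_awalk_verts(1)[of _ p w]) (use Cons.prems(1) in \<open>simp add: awalk_Cons_iff\<close>)
  then show ?case using Cons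
    by (auto simp: awalk_Cons_iff H.awalk_Cons_iff del_vert_simps)
qed

end

context rooted_tree begin

lemma awalk_from_root:
  assumes "v \<in> verts T"
  shows "\<exists>p. awalk r p v"
proof -
  obtain p where p: "pre_digraph.awalk (mk_symmetric T) r p v"
    using connected_awalkE[OF tree_connected root_in_verts assms] .
  obtain q where "awalk r q v"
    using mk_symmetric_awalk_imp_awalk[OF sym_arcs p] .
  then show ?thesis ..
qed

text \<open>
  A walk through a leaf that does not start or end there enters and leaves it through its only
  neighbour; cutting out this detour shortens the walk by two arcs.
\<close>

lemma shortest_awalk_avoids_leaf:
  assumes leaf: "leaf T r u" and p: "awalk r p v" "length p = level T r v" and "v \<noteq> u"
  shows "u \<notin> set (awalk_verts r p)"
proof
  assume "u \<in> set (awalk_verts r p)"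
  then obtain p1 p2 where p12: "p = p1 @ p2" "awalk r p1 u" "awalk u p2 v"
    using awalk_decomp[OF p(1)] by metis
  have "u \<noteq> r" using leaf by (simp add: leaf_def)
  have "p1 \<noteq> []" using awalk_empty_ends[of r u] p12(2) \<open>u \<noteq> r\<close> by metis
  then obtain q1 e where e: "p1 = q1 @ [e]" by (metis rev_exhaust)
  have "p2 \<noteq> []" using awalk_empty_ends[of u v] p12(3) \<open>v \<noteq> u\<close> by metis
  then obtain f q2 where f: "p2 = f # q2" by (metis list.exhaust)
  have "awalk r q1 (awlast r q1)" "awalk (awlast r q1) [e] u"
    using p12(2) unfolding e awalk_append_iff by metis+
  then have e': "awalk r q1 (tail T e)" "e \<in> arcs T" "head T e = u"
    unfolding awalk_simps by metis+
  have f': "f \<in> arcs T" "tail T f = u" "awalk (head T f) q2 v"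
    using p12(3) unfolding f awalk_Cons_iff by metis+
  obtain g where g: "g \<in> arcs T" "tail T g = u" "head T g = tail T e"
    using bspec[OF sym_arcs[unfolded symmetric_conv] e'(2)] unfolding e'(3) by metis
  obtain h where h: "out_arcs T u = {h}"
    using leaf unfolding leaf_def out_degree_def by (metis card_1_singletonE)
  have "g \<in> {h}" "f \<in> {h}"
    unfolding h[symmetric] in_out_arcs_conv using g(1,2) f'(1,2) by simp_all
  then have "head T f = tail T e" using g(3) by simp
  then have "awalk r (q1 @ q2) v"
    using awalk_appendI[OF e'(1)] f'(3) by metis
  from level_le_length[OF this] have "length p \<le> length (q1 @ q2)" unfolding p(2) .
  then show False unfolding p12(1) e f by simp
qed

lemma level_del_leaf:
  assumes leaf: "leaf T r u" and v: "v \<in> verts T" "v \<noteq> u"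
  shows "\<exists>p. pre_digraph.awalk (del_vert u) r p v" "level (del_vert u) r v = level T r v"
proof -
  interpret H: wf_digraph "del_vert u" by (rule wf_digraph_del_vert)
  obtain p where p: "awalk r p v" "length p = level T r v"
    using awalk_from_root[OF v(1)] shortest_awalk by metis
  have p': "H.awalk r p v"
    using awalk_in_del_vert[OF p(1) shortest_awalk_avoids_leaf[OF leaf p v(2)]] .
  then show "\<exists>p. H.awalk r p v" by blast
  obtain q where q: "H.awalk r q v" "length q = level (del_vert u) r v"
    using H.shortest_awalk[OF p'] by blast
  show "level (del_vert u) r v = level T r v"
    using H.level_le_length[OF p'] p(2) level_le_length[OF awalk_del_vert_mono[OF q(1)]] q(2)
    by simp
qed

end

section \<open>Level matrices\<close>

lemma level_matrix_spectrum:
  assumes vs: "enumerates vs V" and image: "level T r ` V = {..m}" and m: "m > 0"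
  shows "eigen_mult (level_matrix T r vs) 0 + Suc m = card V"
    and "(\<Sum>x | eigenvalue (level_matrix T r vs) x \<and> x > 0. eigen_mult (level_matrix T r vs) x) = 1"
proof -
  define f where "f i = level T r (vs ! i)" for i
  have "(!) vs ` {..<length vs} = V"
    using vs unfolding enumerates_def by (auto simp: set_conv_nth)
  then have "f ` {..<length vs} = {..m}"
    using image by (auto simp: f_def)
  note spectrum = distance_matrix_order_0[OF this m] distance_matrix_positive_orders[OF this m]
  have "level_matrix T r vs
      = mat (length vs) (length vs) (\<lambda>(i, j). \<bar>real (f i) - real (f j)\<bar>)"
    by (simp add: level_matrix_def f_def)
  moreover have "length vs = card V"
    using vs unfolding enumerates_def by (metis distinct_card)
  ultimately show "eigen_mult (level_matrix T r vs) 0 + Suc m = card V"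
    and "(\<Sum>x | eigenvalue (level_matrix T r vs) x \<and> x > 0. eigen_mult (level_matrix T r vs) x) = 1"
    unfolding eigen_mult_def using spectrum by (simp_all only:)
qed

theorem theorem13:
  fixes T :: "('a, 'b) pre_digraph" and r :: 'a and vs :: "'a list"
  assumes "rooted_tree T r"
    and "card (verts T) > 2"
    and "enumerates vs (verts T)"
  shows "int (eigen_mult (level_matrix T r vs) 0) = int (card (verts T)) - 1 - int (max_level T r)
    \<and> (\<Sum>x | eigenvalue (level_matrix T r vs) x \<and> x > 0. eigen_mult (level_matrix T r vs) x) = 1
    \<and> (\<forall>v ws. leaf T r v \<longrightarrow> enumerates ws (verts (pre_digraph.del_vert T v)) \<longrightarrow>
        int (eigen_mult (level_matrix T r vs) 0)
          - int (eigen_mult (level_matrix (pre_digraph.del_vert T v) r ws) 0) \<in> {0, 1})"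
proof -
  interpret rooted_tree T r by (rule assms(1))
  define m where "m = max_level T r"
  have fin: "finite (verts T)" by simp
  have image: "level T r ` verts T = {..m}"
    unfolding m_def by (rule level_image[OF fin root_in_verts awalk_from_root])
  have other_root: "\<exists>u\<in>V. u \<noteq> r" if "card V > 1" for V
  proof (rule ccontr)
    assume "\<not> (\<exists>u\<in>V. u \<noteq> r)"
    then have "card V \<le> card {r}" by (intro card_mono) auto
    then show False using that by simp
  qed
  have "\<exists>u\<in>verts T. u \<noteq> r" using other_root assms(2) by simp
  then have m: "m > 0"
    unfolding m_def using max_level_pos[OF fin root_in_verts awalk_from_root] by (elim bexE)
  note spectrum = level_matrix_spectrum[OF assms(3) image m]
  have "int (eigen_mult (level_matrix T r vs) 0)
      - int (eigen_mult (level_matrix (del_vert v) r ws) 0) \<in> {0, 1}"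
    if leaf: "leaf T r v" and ws: "enumerates ws (verts (del_vert v))" for v ws
  proof -
    interpret H: wf_digraph "del_vert v" by (rule wf_digraph_del_vert)
    define m' where "m' = max_level (del_vert v) r"
    have v: "v \<in> verts T" "v \<noteq> r" using leaf by (simp_all add: leaf_def)
    have verts: "verts (del_vert v) = verts T - {v}" by (rule verts_del_vert)
    have fin': "finite (verts (del_vert v))" and root': "r \<in> verts (del_vert v)"
      using fin root_in_verts v by (auto simp: verts)
    have reach': "\<exists>p. H.awalk r p u" if "u \<in> verts (del_vert v)" for u
      by (rule level_del_leaf(1)[OF leaf]) (use that in \<open>simp_all add: verts\<close>)
    have image': "level (del_vert v) r ` verts (del_vert v) = {..m'}"
      unfolding m'_def by (rule H.level_image[OF fin' root' reach'])
    have card': "card (verts T) = Suc (card (verts (del_vert v)))"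
      unfolding verts by (rule card.remove[OF fin v(1)])
    have "\<exists>u\<in>verts (del_vert v). u \<noteq> r" using other_root card' assms(2) by simp
    then have m': "m' > 0"
      unfolding m'_def using H.max_level_pos[OF fin' root' reach'] by (elim bexE)
    have "level (del_vert v) r ` verts (del_vert v) = level T r ` (verts T - {v})"
      unfolding verts by (intro image_cong refl level_del_leaf(2)[OF leaf]) auto
    moreover have "{..m} = insert (level T r v) (level T r ` (verts T - {v}))"
      unfolding image[symmetric] using v(1) by blast
    ultimately have levels: "{..m} = insert (level T r v) {..m'}"
      using image' by simp
    \<comment> \<open>Two initial segments that differ in at most one element.\<close>
    have "m' \<in> {..m}" unfolding levels by simp
    then have "m' \<le> m" by simp
    moreover have "m \<le> Suc m'"
    proof (rule ccontr)
      assume "\<not> m \<le> Suc m'"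
      then have "m \<in> insert (level T r v) {..m'}" "Suc m' \<in> insert (level T r v) {..m'}"
        unfolding levels[symmetric] by simp_all
      then show False using \<open>\<not> m \<le> Suc m'\<close> by auto
    qed
    ultimately have "m = m' \<or> m = Suc m'" by linarith
    moreover note spectrum(1) level_matrix_spectrum(1)[OF ws image' m'] card'
    ultimately have "int (eigen_mult (level_matrix T r vs) 0)
        - int (eigen_mult (level_matrix (del_vert v) r ws) 0) = 1 - (int m - int m')"
      "m = m' \<or> m = Suc m'"
      by linarith+
    then show ?thesis by force
  qed
  moreover have "int (eigen_mult (level_matrix T r vs) 0) = int (card (verts T)) - 1 - int (max_level T r)"
    using spectrum(1) unfolding m_def by linarith
  ultimately show ?thesis by (intro conjI spectrum(2) allI impI)
qed

end
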